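(* Let $A$ be a commutative multiplicative hyperring with identity element $1$, and let $u,v \in \mathbb{N}$ with $u > v$. If $P$ is a $(u,v)$-absorbing primary hyperideal of $A$ which is a $\mathcal{C}$-hyperideal, then $rad(P)$ is a prime hyperideal of $A$.
   Context: $\mathbb{N}$ is the set of positive integers. A commutative multiplicative hyperring $(A,+,\circ)$ consists of an abelian group $(A,+)$ and a map $\circ$ from $A\times A$ to the nonempty subsets of $A$ which is associative ($\bigcup_{a\in y\circ z} x\circ a=\bigcup_{b\in x\circ y} b\circ z$), commutative ($x\circ y=y\circ x$), satisfies $(-x)\circ y=x\circ(-y)=-(x\circ y)$, and $(y+z)\circ x\subseteq y\circ x+z\circ x$, $x\circ(y+z)\subseteq x\circ y+x\circ z$. For subsets $B,C\subseteq A$, $B\circ C=\bigcup_{b\in B,c\in C} b\circ c$ and $B+C=\{b+c: b\in B, c\in C\}$; an iterated product $x_1\circ\cdots\circ x_n$ is a subset of $A$ (for $n=1$ it is $\{x_1\}$). An identity element $1$ satisfies $a\in 1\circ a$ for all $a\in A$. $x\in A$ is a unit if $1\in y\circ x$ for some $y\in A$; $U(A)$ is the set of units. A hyperideal is a nonempty subset $B\subseteq A$ with $x-y\in B$ for all $x,y\in B$ and $r\circ x\subseteq B$ for all $x\in B$, $r\in A$; it is proper if $B\ne A$. A proper hyperideal $B$ is prime if $x\circ y\subseteq B$ ($x,y\in A$) implies $x\in B$ or $y\in B$. $rad(B)$ is the intersection of all prime hyperideals of $A$ containing $B$ (and $rad(B)=A$ if there are none). A hyperideal $B$ is a $\mathcal{C}$-hyperideal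 if for all $n\in\mathbb{N}$ and $a_1,\dots,a_n\in A$, $(a_1\circ\cdots\circ a_n)\cap B\neq\varnothing$ implies $a_1\circ\cdots\circ a_n\subseteq B$. For $u,v\in\mathbb{N}$ with $u>v$, a proper hyperideal $P$ is $(u,v)$-absorbing primary if whenever $x_1,\dots,x_u\in A\setminus U(A)$ and $x_1\circ\cdots\circ x_u\subseteq P$, then $x_1\circ\cdots\circ x_v\subseteq P$ or $x_{v+1}\circ\cdots\circ x_u\subseteq rad(P)$. *)

theory Defs
  imports "HOL-Algebra.AbelCoset"
begin

text \<open>A hyperring extends the ring record by a set-valued product. The zero, addition and
  carrier of the ring record give the additive group and its one is the identity element; the
  single-valued multiplication of the ring record plays no role.\<close>

record 'a hyperring = "'a ring" +
  hmult :: "'a \<Rightarrow> 'a \<Rightarrow> 'a set" (infixl "\<star>\<index>" 70)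

definition hset_mult :: "('a, 'm) hyperring_scheme \<Rightarrow> 'a set \<Rightarrow> 'a set \<Rightarrow> 'a set"
    (infixl "<\<star>>\<index>" 70)
  where "B <\<star>>\<^bsub>A\<^esub> C = (\<Union>b\<in>B. \<Union>c\<in>C. b \<star>\<^bsub>A\<^esub> c)"

locale comm_mult_hyperring = abelian_group A for A :: "('a, 'm) hyperring_scheme" (structure) +
  assumes hmult_closed: "\<lbrakk>x \<in> carrier A; y \<in> carrier A\<rbrakk> \<Longrightarrow> x \<star> y \<subseteq> carrier A"
    and hmult_nonempty: "\<lbrakk>x \<in> carrier A; y \<in> carrier A\<rbrakk> \<Longrightarrow> x \<star> y \<noteq> {}"
    and hmult_assoc: "\<lbrakk>x \<in> carrier A; y \<in> carrier A; z \<in> carrier A\<rbrakk> \<Longrightarrow>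
          (\<Union>a\<in>y \<star> z. x \<star> a) = (\<Union>b\<in>x \<star> y. b \<star> z)"
    and hmult_comm: "\<lbrakk>x \<in> carrier A; y \<in> carrier A\<rbrakk> \<Longrightarrow> x \<star> y = y \<star> x"
    and hmult_minus_left: "\<lbrakk>x \<in> carrier A; y \<in> carrier A\<rbrakk> \<Longrightarrow>
          (\<ominus> x) \<star> y = (\<lambda>z. \<ominus> z) ` (x \<star> y)"
    and hmult_minus_right: "\<lbrakk>x \<in> carrier A; y \<in> carrier A\<rbrakk> \<Longrightarrow>
          x \<star> (\<ominus> y) = (\<lambda>z. \<ominus> z) ` (x \<star> y)"
    and hmult_distrib_right: "\<lbrakk>x \<in> carrier A; y \<in> carrier A; z \<in> carrier A\<rbrakk> \<Longrightarrow>
          (y \<oplus> z) \<star> x \<subseteq> (y \<star> x) <+> (z \<star> x)"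
    and hmult_distrib_left: "\<lbrakk>x \<in> carrier A; y \<in> carrier A; z \<in> carrier A\<rbrakk> \<Longrightarrow>
          x \<star> (y \<oplus> z) \<subseteq> (x \<star> y) <+> (x \<star> z)"

locale comm_mult_hyperring_1 = comm_mult_hyperring +
  assumes hone_closed: "\<one> \<in> carrier A"
    and hone_mem: "a \<in> carrier A \<Longrightarrow> a \<in> \<one> \<star> a"

text \<open>The iterated product of a nonempty list; by associativity the bracketing is immaterial.
  The value on the empty list is arbitrary and never used: it is not an identity for the product,
  since \<open>\<one> \<star> a\<close> may differ from \<open>{a}\<close>.\<close>

fun hprod :: "('a, 'm) hyperring_scheme \<Rightarrow> 'a list \<Rightarrow> 'a set" where
  "hprod A [] = {}"
| "hprod A [x] = {x}"
| "hprod A (x # y # ys) = {x} <\<star>>\<^bsub>A\<^esub> hprod A (y # ys)"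

definition hunits :: "('a, 'm) hyperring_scheme \<Rightarrow> 'a set" where
  "hunits A = {x \<in> carrier A. \<exists>y\<in>carrier A. \<one>\<^bsub>A\<^esub> \<in> y \<star>\<^bsub>A\<^esub> x}"

definition hyperideal :: "('a, 'm) hyperring_scheme \<Rightarrow> 'a set \<Rightarrow> bool" where
  "hyperideal A B \<longleftrightarrow> B \<subseteq> carrier A \<and> B \<noteq> {} \<and>
     (\<forall>x\<in>B. \<forall>y\<in>B. x \<ominus>\<^bsub>A\<^esub> y \<in> B) \<and>
     (\<forall>x\<in>B. \<forall>r\<in>carrier A. r \<star>\<^bsub>A\<^esub> x \<subseteq> B)"

definition proper_hyperideal :: "('a, 'm) hyperring_scheme \<Rightarrow> 'a set \<Rightarrow> bool" where
  "proper_hyperideal A B \<longleftrightarrow> hyperideal A B \<and> B \<noteq> carrier A"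

definition prime_hyperideal :: "('a, 'm) hyperring_scheme \<Rightarrow> 'a set \<Rightarrow> bool" where
  "prime_hyperideal A B \<longleftrightarrow> proper_hyperideal A B \<and>
     (\<forall>x\<in>carrier A. \<forall>y\<in>carrier A. x \<star>\<^bsub>A\<^esub> y \<subseteq> B \<longrightarrow> x \<in> B \<or> y \<in> B)"

text \<open>Intersecting with the carrier only matters when no prime hyperideal contains \<open>B\<close>;
  the radical is then the whole carrier.\<close>

definition hrad :: "('a, 'm) hyperring_scheme \<Rightarrow> 'a set \<Rightarrow> 'a set" where
  "hrad A B = carrier A \<inter> \<Inter>{Q. prime_hyperideal A Q \<and> B \<subseteq> Q}"

definition C_hyperideal :: "('a, 'm) hyperring_scheme \<Rightarrow> 'a set \<Rightarrow> bool" where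
  "C_hyperideal A B \<longleftrightarrow> hyperideal A B \<and>
     (\<forall>as. as \<noteq> [] \<and> set as \<subseteq> carrier A \<and> hprod A as \<inter> B \<noteq> {} \<longrightarrow> hprod A as \<subseteq> B)"

text \<open>Meaningful for \<open>0 < v < u\<close>, so that both parts of the list are nonempty.\<close>

definition absorbing_primary ::
    "('a, 'm) hyperring_scheme \<Rightarrow> nat \<Rightarrow> nat \<Rightarrow> 'a set \<Rightarrow> bool" where
  "absorbing_primary A u v P \<longleftrightarrow> proper_hyperideal A P \<and>
     (\<forall>xs. length xs = u \<and> set xs \<subseteq> carrier A - hunits A \<and> hprod A xs \<subseteq> P \<longrightarrow>
        hprod A (take v xs) \<subseteq> P \<or> hprod A (drop v xs) \<subseteq> hrad A P)"

end

theory Submission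
  imports Defs
begin

text \<open>For a \<open>\<C>\<close>-hyperideal \<open>P\<close>, Krull's separation argument identifies the radical with the set of
  elements some power of which lies in \<open>P\<close>. Let \<open>x\<close> and \<open>y\<close> be nonunits with
  \<open>x \<star> y \<subseteq> rad P\<close>. A power of some \<open>c \<in> x \<star> y\<close> lies in \<open>P\<close> and in \<open>x\<^sup>n \<star> y\<^sup>n\<close>, so the
  \<open>\<C>\<close>-property gives \<open>x\<^sup>n \<star> y\<^sup>n \<subseteq> P\<close>. Choose \<open>s \<in> x\<^sup>n\<close> and \<open>t \<in> y\<^sup>n\<close>; both are nonunits and
  \<open>s \<star> t \<subseteq> P\<close>. Absorption applied to \<open>v\<close> copies of \<open>s\<close> and \<open>u - v\<close> copies of \<open>t\<close> puts \<open>s\<close>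
  or \<open>t\<close> in the radical, and by the \<open>\<C>\<close>-property this passes to \<open>x\<close> or \<open>y\<close>.\<close>

section \<open>Elimination rules and monotonicity of the set product\<close>

lemma hyperidealD:
  assumes "hyperideal A B"
  shows "B \<subseteq> carrier A" "B \<noteq> {}"
    "\<And>x y. x \<in> B \<Longrightarrow> y \<in> B \<Longrightarrow> x \<ominus>\<^bsub>A\<^esub> y \<in> B"
    "\<And>x r. x \<in> B \<Longrightarrow> r \<in> carrier A \<Longrightarrow> r \<star>\<^bsub>A\<^esub> x \<subseteq> B"
  using assms unfolding hyperideal_def by auto

lemma prime_hyperidealD:
  assumes "prime_hyperideal A B"
  shows "hyperideal A B" "B \<noteq> carrier A"
    "\<And>x y. x \<in> carrier A \<Longrightarrow> y \<in> carrier A \<Longrightarrow> x \<star>\<^bsub>A\<^esub> y \<subseteq> B \<Longrightarrow> x \<in> B \<or> y \<in> B"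
  using assms unfolding prime_hyperideal_def proper_hyperideal_def by auto

lemma C_hyperidealD:
  assumes "C_hyperideal A B" "as \<noteq> []" "set as \<subseteq> carrier A" "hprod A as \<inter> B \<noteq> {}"
  shows "hprod A as \<subseteq> B"
  using assms unfolding C_hyperideal_def by blast

lemma hset_mult_mono: "B \<subseteq> B' \<Longrightarrow> C \<subseteq> C' \<Longrightarrow> B <\<star>>\<^bsub>A\<^esub> C \<subseteq> B' <\<star>>\<^bsub>A\<^esub> C'"
  unfolding hset_mult_def by blast

lemma hset_multI: "b \<in> B \<Longrightarrow> c \<in> C \<Longrightarrow> b \<star>\<^bsub>A\<^esub> c \<subseteq> B <\<star>>\<^bsub>A\<^esub> C"
  unfolding hset_mult_def by blast

lemma hset_mult_singletons [simp]: "{x} <\<star>>\<^bsub>A\<^esub> {y} = x \<star>\<^bsub>A\<^esub> y"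
  unfolding hset_mult_def by simp

lemma hprod_Cons: "xs \<noteq> [] \<Longrightarrow> hprod A (x # xs) = {x} <\<star>>\<^bsub>A\<^esub> hprod A xs"
  by (cases xs) auto

lemma subset_hrad: "P \<subseteq> carrier A \<Longrightarrow> P \<subseteq> hrad A P"
  unfolding hrad_def by blast

section \<open>Algebra of products of subsets\<close>

context comm_mult_hyperring
begin

lemma hset_mult_closed:
  "\<lbrakk>B \<subseteq> carrier A; C \<subseteq> carrier A\<rbrakk> \<Longrightarrow> B <\<star>> C \<subseteq> carrier A"
  unfolding hset_mult_def using hmult_closed by blast

lemma hset_mult_nonempty:
  assumes "B \<subseteq> carrier A" "C \<subseteq> carrier A" "B \<noteq> {}" "C \<noteq> {}"
  shows "B <\<star>> C \<noteq> {}"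
proof -
  obtain b c where "b \<in> B" "c \<in> C" using assms by blast
  then show ?thesis
    unfolding hset_mult_def using hmult_nonempty [of b c] assms by blast
qed

lemma hset_mult_comm:
  assumes "B \<subseteq> carrier A" "C \<subseteq> carrier A"
  shows "B <\<star>> C = C <\<star>> B"
proof -
  have "b \<star> c = c \<star> b" if "b \<in> B" "c \<in> C" for b c
    using assms that by (intro hmult_comm) auto
  then show ?thesis
    unfolding hset_mult_def by fastforce
qed

lemma hset_mult_assoc:
  assumes "B \<subseteq> carrier A" "C \<subseteq> carrier A" "D \<subseteq> carrier A"
  shows "(B <\<star>> C) <\<star>> D = B <\<star>> (C <\<star>> D)"
proof -
  have "(B <\<star>> C) <\<star>> D = (\<Union>b\<in>B. \<Union>c\<in>C. \<Union>d\<in>D. \<Union>e\<in>b \<star> c. e \<star> d)"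
    unfolding hset_mult_def by blast
  also have "\<dots> = (\<Union>b\<in>B. \<Union>c\<in>C. \<Union>d\<in>D. \<Union>e\<in>c \<star> d. b \<star> e)"
    using assms by (intro SUP_cong [OF refl] hmult_assoc [symmetric]) auto
  also have "\<dots> = B <\<star>> (C <\<star>> D)"
    unfolding hset_mult_def by blast
  finally show ?thesis .
qed

lemma hset_mult_left_comm:
  assumes "B \<subseteq> carrier A" "C \<subseteq> carrier A" "D \<subseteq> carrier A"
  shows "B <\<star>> (C <\<star>> D) = C <\<star>> (B <\<star>> D)"
  using hset_mult_assoc [OF assms] hset_mult_assoc [OF assms(2,1,3)] hset_mult_comm [OF assms(1,2)]
  by simp

lemma hset_mult_interchange:
  assumes "B \<subseteq> carrier A" "C \<subseteq> carrier A" "D \<subseteq> carrier A" "E \<subseteq> carrier A"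
  shows "(B <\<star>> C) <\<star>> (D <\<star>> E) = (B <\<star>> D) <\<star>> (C <\<star>> E)"
  using assms by (simp add: hset_mult_assoc hset_mult_closed hset_mult_left_comm [of C D E])

section \<open>Iterated products and powers\<close>

lemma hprod_closed: "set xs \<subseteq> carrier A \<Longrightarrow> hprod A xs \<subseteq> carrier A"
proof (induction xs rule: induct_list012)
  case (3 x y zs)
  then show ?case
    using hset_mult_closed [of "{x}" "hprod A (y # zs)"] by simp
qed auto

lemma hprod_nonempty: "\<lbrakk>xs \<noteq> []; set xs \<subseteq> carrier A\<rbrakk> \<Longrightarrow> hprod A xs \<noteq> {}"
proof (induction xs rule: list_nonempty_induct)
  case (cons x xs)
  then show ?case
    by (simp add: hprod_Cons hset_mult_nonempty hprod_closed)
qed simp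

lemma hprod_append:
  assumes "xs \<noteq> []" "ys \<noteq> []" "set xs \<subseteq> carrier A" "set ys \<subseteq> carrier A"
  shows "hprod A (xs @ ys) = hprod A xs <\<star>> hprod A ys"
  using assms
proof (induction xs rule: list_nonempty_induct)
  case (cons x xs)
  then show ?case
    by (simp add: hprod_Cons hset_mult_assoc hprod_closed)
qed (simp add: hprod_Cons)

text \<open>Here \<open>L\<close> stands for a power of \<open>s\<close>. Enlarging each factor
  \<open>s\<close> to the set \<open>hprod A xs\<close> and removing brackets gives the repeated
  list. When \<open>xs\<close> is itself a power of \<open>x\<close>, this places a power of
  \<open>s\<close> inside a power of \<open>x\<close>.\<close>

lemma hprod_subset_hprod_concat:
  assumes "L \<noteq> []" "set L \<subseteq> {s}" "s \<in> hprod A xs" "xs \<noteq> []" "set xs \<subseteq> carrier A"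
  shows "hprod A L \<subseteq> hprod A (concat (map (\<lambda>_. xs) L))"
  using assms
proof (induction L rule: list_nonempty_induct)
  case (cons y L)
  have "concat (map (\<lambda>_. xs) L) \<noteq> []" "set (concat (map (\<lambda>_. xs) L)) \<subseteq> carrier A"
    using cons by (cases L; auto)+
  then show ?case
    using cons by (simp add: hprod_Cons hprod_append hset_mult_mono)
qed simp

text \<open>The counterpart of expanding a power of a product into a product of powers. Since
  \<open>c\<close> is only one element of \<open>x \<star> y\<close>, an inclusion is what survives;
  each induction step regroups four factors by interchange.\<close>

lemma hprod_subset_split:
  assumes "L \<noteq> []" "set L \<subseteq> {c}" "c \<in> x \<star> y" "x \<in> carrier A" "y \<in> carrier A"
  shows "hprod A L \<subseteq> hprod A (map (\<lambda>_. x) L) <\<star>> hprod A (map (\<lambda>_. y) L)"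
  using assms
proof (induction L rule: list_nonempty_induct)
  case (cons z L)
  let ?X = "hprod A (map (\<lambda>_. x) L)" and ?Y = "hprod A (map (\<lambda>_. y) L)"
  have cl: "?X \<subseteq> carrier A" "?Y \<subseteq> carrier A"
    using cons.prems by (intro hprod_closed; auto)+
  have "hprod A (z # L) \<subseteq> ({x} <\<star>> {y}) <\<star>> (?X <\<star>> ?Y)"
    using cons by (simp add: hprod_Cons hset_mult_mono)
  also have "\<dots> = ({x} <\<star>> ?X) <\<star>> ({y} <\<star>> ?Y)"
    using cons.prems cl by (intro hset_mult_interchange) auto
  finally show ?case
    using cons.hyps by (simp add: hprod_Cons)
qed simp

lemma hprod_subset_hyperideal:
  assumes "hyperideal A B" "xs \<noteq> []" "set xs \<subseteq> B"
  shows "hprod A xs \<subseteq> B"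
  using assms(2,3)
proof (induction xs rule: list_nonempty_induct)
  case (cons x xs)
  then have "x \<star> b \<subseteq> B" if "b \<in> hprod A xs" for b
    using hyperidealD(1,4) [OF assms(1)] that by (intro hyperidealD(4) [OF assms(1)]) auto
  then show ?case
    using cons.hyps by (auto simp: hprod_Cons hset_mult_def)
qed simp

text \<open>Primality speaks of two elements, whereas the tail of the list contributes a set. If
  \<open>x\<close> is outside \<open>Q\<close>, primality is applied to \<open>x\<close> and each
  element \<open>b\<close> of the tail product, which puts the whole tail product in
  \<open>Q\<close>.\<close>

lemma hprod_subset_prime:
  assumes "prime_hyperideal A Q" "xs \<noteq> []" "set xs \<subseteq> carrier A" "hprod A xs \<subseteq> Q"
  shows "\<exists>x\<in>set xs. x \<in> Q"
  using assms(2-)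
proof (induction xs rule: list_nonempty_induct)
  case (cons x xs)
  show ?case
  proof (cases "x \<in> Q")
    case False
    have "b \<in> Q" if "b \<in> hprod A xs" for b
    proof -
      have "x \<star> b \<subseteq> Q"
        using cons that by (auto simp: hprod_Cons hset_mult_def)
      then show ?thesis
        using prime_hyperidealD(3) [OF assms(1), of x b] False cons.prems hprod_closed [of xs] that
        by auto
    qed
    then have "hprod A xs \<subseteq> Q" by blast
    then show ?thesis using cons by simp
  qed simp
qed simp

section \<open>Closure properties of hyperideals and colon hyperideals\<close>

lemma hyperideal_zero:
  assumes "hyperideal A B"
  shows "\<zero> \<in> B"
proof -
  obtain x where "x \<in> B" "x \<in> carrier A"
    using hyperidealD(1,2) [OF assms] by blast
  then show ?thesis
    using hyperidealD(3) [OF assms, of x x] by (simp add: minus_eq r_neg)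
qed

lemma hyperideal_minus:
  assumes "hyperideal A B" "x \<in> B"
  shows "\<ominus> x \<in> B"
proof -
  have "x \<in> carrier A" using hyperidealD(1) assms by blast
  then show ?thesis
    using hyperidealD(3) [OF assms(1) hyperideal_zero [OF assms(1)] assms(2)]
    by (simp add: minus_eq)
qed

lemma hyperideal_add:
  assumes "hyperideal A B" "x \<in> B" "y \<in> B"
  shows "x \<oplus> y \<in> B"
proof -
  have "y \<in> carrier A" using hyperidealD(1) assms by blast
  then show ?thesis
    using hyperidealD(3) [OF assms(1,2) hyperideal_minus [OF assms(1,3)]] by (simp add: minus_eq)
qed

lemma hyperideal_mult_right:
  assumes "hyperideal A B" "x \<in> B" "r \<in> carrier A"
  shows "x \<star> r \<subseteq> B"
proof -
  have "x \<in> carrier A" using hyperidealD(1) assms by blast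
  then show ?thesis
    using hyperidealD(4) [OF assms] hmult_comm [of x r] assms(3) by simp
qed

text \<open>The one-sided distributive inclusion suffices: only an upper bound for
  \<open>(x \<ominus> y) \<star> b\<close> is required. Closure under multiplication comes from
  associativity.\<close>

lemma hyperideal_colon:
  assumes Q: "hyperideal A Q" and b: "b \<in> carrier A"
  shows "hyperideal A {r \<in> carrier A. r \<star> b \<subseteq> Q}"
  unfolding hyperideal_def
proof (intro conjI ballI)
  have "Q \<subseteq> {r \<in> carrier A. r \<star> b \<subseteq> Q}"
    using hyperidealD(1) [OF Q] hyperideal_mult_right [OF Q _ b] by blast
  then show "{r \<in> carrier A. r \<star> b \<subseteq> Q} \<noteq> {}"
    using hyperidealD(2) [OF Q] by blast
next
  fix x y assume x: "x \<in> {r \<in> carrier A. r \<star> b \<subseteq> Q}" and y: "y \<in> {r \<in> carrier A. r \<star> b \<subseteq> Q}"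
  have "(x \<ominus> y) \<star> b \<subseteq> x \<star> b <+> (\<ominus> y) \<star> b"
    using x y b by (simp add: minus_eq hmult_distrib_right)
  also have "\<dots> \<subseteq> Q"
  proof -
    have "c \<oplus> \<ominus> d \<in> Q" if "c \<in> x \<star> b" "d \<in> y \<star> b" for c d
      using x y that by (intro hyperideal_add [OF Q] hyperideal_minus [OF Q]) auto
    then show ?thesis
      using y b by (auto simp: set_add_def' hmult_minus_left)
  qed
  finally show "x \<ominus> y \<in> {r \<in> carrier A. r \<star> b \<subseteq> Q}"
    using x y by simp
next
  fix x r assume x: "x \<in> {r \<in> carrier A. r \<star> b \<subseteq> Q}" and r: "r \<in> carrier A"
  have "(\<Union>z\<in>r \<star> x. z \<star> b) = (\<Union>z\<in>x \<star> b. r \<star> z)"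
    using x r b by (simp add: hmult_assoc)
  also have "\<dots> \<subseteq> Q"
    using x by (intro UN_least hyperidealD(4) [OF Q _ r]) auto
  finally show "r \<star> x \<subseteq> {r \<in> carrier A. r \<star> b \<subseteq> Q}"
    using x r hmult_closed [of r x] by blast
qed auto

section \<open>Prime hyperideals from Zorn's lemma\<close>

lemma hyperideal_Union_chain:
  assumes "\<And>B. B \<in> \<C> \<Longrightarrow> hyperideal A B" "\<C> \<noteq> {}"
    "\<And>B C. B \<in> \<C> \<Longrightarrow> C \<in> \<C> \<Longrightarrow> B \<subseteq> C \<or> C \<subseteq> B"
  shows "hyperideal A (\<Union>\<C>)"
  unfolding hyperideal_def
proof (intro conjI ballI)
  show "\<Union>\<C> \<subseteq> carrier A" "\<Union>\<C> \<noteq> {}"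
    using assms(1,2) hyperidealD(1,2) by blast+
next
  fix x y assume "x \<in> \<Union>\<C>" "y \<in> \<Union>\<C>"
  then obtain B where "B \<in> \<C>" "x \<in> B" "y \<in> B"
    using assms(3) by blast
  then show "x \<ominus> y \<in> \<Union>\<C>"
    using hyperidealD(3) [OF assms(1)] by blast
next
  fix x r assume "x \<in> \<Union>\<C>" "r \<in> carrier A"
  then obtain B where "B \<in> \<C>" "r \<star> x \<subseteq> B"
    using hyperidealD(4) [OF assms(1)] by blast
  then show "r \<star> x \<subseteq> \<Union>\<C>" by blast
qed

text \<open>Colon hyperideals replace the hyperideals generated by \<open>Q\<close> and one further element, whose
  elements have no convenient description under weak distributivity.\<close>

lemma prime_hyperideal_separation:
  assumes I: "hyperideal A I" and S: "S \<subseteq> carrier A" "S \<noteq> {}" "I \<inter> S = {}"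
    and mult: "\<And>s t. s \<in> S \<Longrightarrow> t \<in> S \<Longrightarrow> s \<star> t \<inter> S \<noteq> {}"
  obtains Q where "prime_hyperideal A Q" "I \<subseteq> Q" "Q \<inter> S = {}"
proof -
  define F where "F = {B. hyperideal A B \<and> I \<subseteq> B \<and> B \<inter> S = {}}"
  have "\<exists>Q\<in>F. \<forall>B\<in>F. Q \<subseteq> B \<longrightarrow> B = Q"
  proof (rule subset_Zorn_nonempty)
    show "F \<noteq> {}" using I S unfolding F_def by blast
  next
    fix \<C> assume "\<C> \<noteq> {}" and chain: "subset.chain F \<C>"
    have "\<C> \<subseteq> F" and *: "\<And>B C. B \<in> \<C> \<Longrightarrow> C \<in> \<C> \<Longrightarrow> B \<subseteq> C \<or> C \<subseteq> B"
      using chain unfolding subset_chain_def by auto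
    then have \<C>: "\<And>B. B \<in> \<C> \<Longrightarrow> hyperideal A B \<and> I \<subseteq> B \<and> B \<inter> S = {}"
      unfolding F_def by auto
    then have "hyperideal A (\<Union>\<C>)"
      using \<open>\<C> \<noteq> {}\<close> * by (intro hyperideal_Union_chain) metis+
    moreover have "I \<subseteq> \<Union>\<C>" "\<Union>\<C> \<inter> S = {}"
      using \<C> \<open>\<C> \<noteq> {}\<close> by fast+
    ultimately show "\<Union>\<C> \<in> F"
      unfolding F_def by simp
  qed
  then obtain Q where "Q \<in> F" and maxF: "\<And>B. B \<in> F \<Longrightarrow> Q \<subseteq> B \<Longrightarrow> B = Q"
    by metis
  then have Q: "hyperideal A Q" "I \<subseteq> Q" "Q \<inter> S = {}"
    unfolding F_def by auto
  have max: "B = Q" if "hyperideal A B" "Q \<subseteq> B" "B \<inter> S = {}" for B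
    using that Q(2) by (intro maxF) (auto simp: F_def)
  \<comment> \<open>The colon hyperideal of \<open>Q\<close> by \<open>b\<close> contains
    \<open>Q\<close> and also \<open>a\<close>, so it is strictly larger and by maximality must meet
    \<open>S\<close>.\<close>
  have colon: "\<exists>s\<in>S. s \<star> b \<subseteq> Q"
    if ab: "a \<in> carrier A" "b \<in> carrier A" "a \<star> b \<subseteq> Q" "a \<notin> Q" for a b
  proof -
    let ?B = "{r \<in> carrier A. r \<star> b \<subseteq> Q}"
    have "Q \<subseteq> ?B"
      using hyperidealD(1) [OF Q(1)] hyperideal_mult_right [OF Q(1) _ ab(2)] by auto
    moreover have "?B \<noteq> Q"
      using ab by auto
    ultimately have "?B \<inter> S \<noteq> {}"
      using max [OF hyperideal_colon [OF Q(1) ab(2)]] by metis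
    then show ?thesis by auto
  qed
  have "a \<in> Q \<or> b \<in> Q"
    if ab: "a \<in> carrier A" "b \<in> carrier A" "a \<star> b \<subseteq> Q" for a b
  proof (rule ccontr)
    assume neg: "\<not> (a \<in> Q \<or> b \<in> Q)"
    \<comment> \<open>Two exchanges replace the factors by elements of \<open>S\<close>: first
      \<open>a\<close> by \<open>s\<close>, then, after commuting, \<open>b\<close> by
      \<open>t\<close>. The resulting \<open>t \<star> s\<close> lies in \<open>Q\<close> and yet
      meets \<open>S\<close>.\<close>
    then obtain s where s: "s \<in> S" "s \<star> b \<subseteq> Q"
      using colon [of a b] ab by auto
    then have "b \<star> s \<subseteq> Q"
      using S(1) ab(2) hmult_comm [of b s] by auto
    then obtain t where "t \<in> S" "t \<star> s \<subseteq> Q"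
      using colon [of b s] ab(2) s S(1) neg by auto
    then show False
      using mult [of t s] s Q(3) by blast
  qed
  moreover have "Q \<noteq> carrier A" using Q(3) S(1,2) by auto
  ultimately have "prime_hyperideal A Q"
    unfolding prime_hyperideal_def proper_hyperideal_def using Q(1) by simp
  then show thesis using that Q by blast
qed

section \<open>The radical and powers of its elements\<close>

lemma hyperideal_hrad: "hyperideal A (hrad A P)"
  unfolding hyperideal_def
proof (intro conjI ballI)
  have "\<zero> \<in> hrad A P"
    unfolding hrad_def by (auto intro: hyperideal_zero prime_hyperidealD(1))
  then show "hrad A P \<noteq> {}" by blast
next
  fix x y assume "x \<in> hrad A P" "y \<in> hrad A P"
  then show "x \<ominus> y \<in> hrad A P"
    unfolding hrad_def by (auto intro: hyperidealD(3) [OF prime_hyperidealD(1)])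
next
  fix x r assume "x \<in> hrad A P" "r \<in> carrier A"
  then have "r \<star> x \<subseteq> Q" if "prime_hyperideal A Q" "P \<subseteq> Q" for Q
    using hyperidealD(4) [OF prime_hyperidealD(1) [OF that(1)], of x r] that
    unfolding hrad_def by auto
  moreover have "r \<star> x \<subseteq> carrier A"
    using \<open>x \<in> hrad A P\<close> \<open>r \<in> carrier A\<close> hmult_closed [of r x] unfolding hrad_def by simp
  ultimately show "r \<star> x \<subseteq> hrad A P"
    unfolding hrad_def by (intro Int_greatest Inter_greatest) auto
qed (auto simp: hrad_def)

text \<open>A list \<open>L\<close> with \<open>set L \<subseteq> {x}\<close> encodes a power of \<open>x\<close>.\<close>

lemma hprod_power_in_hrad:
  assumes "L \<noteq> []" "set L \<subseteq> {x}" "x \<in> carrier A" "hprod A L \<subseteq> hrad A P"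
  shows "x \<in> hrad A P"
proof -
  have "x \<in> Q" if "prime_hyperideal A Q" "P \<subseteq> Q" for Q
  proof -
    have "hrad A P \<subseteq> Q" "set L \<subseteq> carrier A"
      using that assms(2,3) unfolding hrad_def by auto
    then have "\<exists>z\<in>set L. z \<in> Q"
      using assms(1,4) that(1) by (intro hprod_subset_prime) auto
    then show ?thesis using assms(2) by auto
  qed
  then show ?thesis unfolding hrad_def using assms(3) by simp
qed

text \<open>Krull's argument with \<open>S\<close> the union of all powers of \<open>x\<close>. If
  no power lay in \<open>P\<close>, a prime hyperideal containing \<open>P\<close> and disjoint from
  \<open>S\<close> would exist, and it would miss \<open>x\<close>.\<close>

lemma hrad_power:
  assumes P: "C_hyperideal A P" and x: "x \<in> hrad A P"
  shows "\<exists>L. L \<noteq> [] \<and> set L \<subseteq> {x} \<and> hprod A L \<subseteq> P"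
proof (rule ccontr)
  assume neg: "\<nexists>L. L \<noteq> [] \<and> set L \<subseteq> {x} \<and> hprod A L \<subseteq> P"
  have xA: "x \<in> carrier A" using x unfolding hrad_def by simp
  define S where "S = (\<Union>L\<in>{L. L \<noteq> [] \<and> set L \<subseteq> {x}}. hprod A L)"
  have xS: "x \<in> S" unfolding S_def by (intro UN_I [of "[x]"]) auto
  have SA: "S \<subseteq> carrier A"
    unfolding S_def using xA by (intro UN_least hprod_closed) auto
  \<comment> \<open>Separation needs disjointness from \<open>P\<close>, while the assumption only
    denies inclusion; the \<open>C_hyperideal\<close> property bridges the gap.\<close>
  have "hprod A L \<inter> P = {}" if "L \<noteq> []" "set L \<subseteq> {x}" for L
  proof (rule ccontr)
    assume "hprod A L \<inter> P \<noteq> {}"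
    then have "hprod A L \<subseteq> P"
      using that xA by (intro C_hyperidealD [OF P]) auto
    then show False using neg that by metis
  qed
  then have "P \<inter> S = {}" unfolding S_def by fastforce
  moreover have "s \<star> t \<inter> S \<noteq> {}" if st: "s \<in> S" "t \<in> S" for s t
  proof -
    obtain L M where L: "L \<noteq> []" "set L \<subseteq> {x}" "s \<in> hprod A L"
      and M: "M \<noteq> []" "set M \<subseteq> {x}" "t \<in> hprod A M"
      using st unfolding S_def by blast
    \<comment> \<open>Concatenating the lists adds the exponents.\<close>
    have "s \<star> t \<subseteq> hprod A (L @ M)"
      using L M xA hset_multI [OF L(3) M(3)] by (subst hprod_append) auto
    also have "\<dots> \<subseteq> S"
      unfolding S_def using L M by (intro UN_upper) auto
    finally show ?thesis
      using hmult_nonempty [of s t] st SA by auto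
  qed
  moreover have "hyperideal A P" using P unfolding C_hyperideal_def by simp
  moreover have "S \<noteq> {}" using xS by auto
  ultimately obtain Q where "prime_hyperideal A Q" "P \<subseteq> Q" "Q \<inter> S = {}"
    using prime_hyperideal_separation [of P S] SA by metis
  then show False using x xS unfolding hrad_def by auto
qed

text \<open>Some power of \<open>s\<close> lies in \<open>P\<close>. It is nonempty and contained in
  a power of \<open>x\<close>, so that power of \<open>x\<close> meets \<open>P\<close> and hence
  lies in \<open>P\<close>.\<close>

lemma hrad_root:
  assumes P: "C_hyperideal A P" and x: "x \<in> carrier A"
    and X: "X \<noteq> []" "set X \<subseteq> {x}" "s \<in> hprod A X" and s: "s \<in> hrad A P"
  shows "x \<in> hrad A P"
proof -
  obtain L where L: "L \<noteq> []" "set L \<subseteq> {s}" "hprod A L \<subseteq> P"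
    using hrad_power [OF P s] by metis
  let ?M = "concat (map (\<lambda>_. X) L)"
  have XA: "set X \<subseteq> carrier A" using X x by blast
  have M: "?M \<noteq> []" "set ?M \<subseteq> {x}"
    using L X by (cases L; auto)+
  have "hprod A L \<subseteq> hprod A ?M"
    using L(1,2) X(3,1) XA by (rule hprod_subset_hprod_concat)
  moreover have "hprod A L \<noteq> {}"
    using L(1,2) s by (intro hprod_nonempty) (auto simp: hrad_def)
  ultimately have "hprod A ?M \<inter> P \<noteq> {}"
    using L(3) by auto
  then have "hprod A ?M \<subseteq> P"
    using M x by (intro C_hyperidealD [OF P M(1)]) auto
  moreover have "P \<subseteq> hrad A P"
    using P unfolding C_hyperideal_def by (intro subset_hrad hyperidealD(1)) simp
  ultimately have "hprod A ?M \<subseteq> hrad A P" by simp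
  then show ?thesis by (rule hprod_power_in_hrad [OF M x])
qed

section \<open>Units, and products of repeated factors\<close>

text \<open>If \<open>z\<close> inverts \<open>c\<close>, associativity moves \<open>\<one>\<close>
  from \<open>z \<star> (a \<star> b)\<close> to \<open>(z \<star> a) \<star> b\<close>, so some
  element of \<open>z \<star> a\<close> inverts \<open>b\<close>.\<close>

lemma hunits_factors:
  assumes "x \<in> carrier A" "y \<in> carrier A" "c \<in> x \<star> y" "c \<in> hunits A"
  shows "x \<in> hunits A" "y \<in> hunits A"
proof -
  have *: "b \<in> hunits A" if ab: "a \<in> carrier A" "b \<in> carrier A" "c \<in> a \<star> b" for a b
  proof -
    obtain z where z: "z \<in> carrier A" "\<one> \<in> z \<star> c"
      using assms(4) unfolding hunits_def by auto
    have "\<one> \<in> (\<Union>w\<in>a \<star> b. z \<star> w)" using ab(3) z(2) by auto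
    also have "\<dots> = (\<Union>w\<in>z \<star> a. w \<star> b)" using z(1) ab(1,2) by (rule hmult_assoc)
    finally show ?thesis
      unfolding hunits_def using hmult_closed [OF z(1) ab(1)] ab(2) by auto
  qed
  show "y \<in> hunits A" using assms(1-3) by (rule *)
  show "x \<in> hunits A" using * [of y x] hmult_comm [of x y] assms(1-3) by simp
qed

text \<open>Read contrapositively: every element of a power of a nonunit is a nonunit, so absorption
  can be applied to it.\<close>

lemma hunits_hprod_factors:
  assumes "xs \<noteq> []" "set xs \<subseteq> carrier A" "c \<in> hprod A xs" "c \<in> hunits A"
  shows "set xs \<subseteq> hunits A"
  using assms
proof (induction xs arbitrary: c rule: list_nonempty_induct)
  case (cons x xs)
  then obtain w where w: "w \<in> hprod A xs" "c \<in> x \<star> w"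
    by (auto simp: hprod_Cons hset_mult_def)
  then have "x \<in> hunits A" "w \<in> hunits A"
    using hunits_factors [of x w c] hprod_closed [of xs] cons.prems by auto
  then show ?case using cons w by auto
qed simp

text \<open>The element \<open>t\<close> lies in the colon hyperideal of \<open>B\<close> by
  \<open>s\<close>, hence so does the whole block of copies of \<open>t\<close>. One factor
  \<open>s\<close> then brings the product into \<open>B\<close>, and further factors keep it
  there.\<close>

lemma hprod_replicate_append_subset:
  assumes B: "hyperideal A B" and s: "s \<in> carrier A" and t: "t \<in> carrier A"
    and st: "s \<star> t \<subseteq> B" and mn: "0 < m" "0 < n"
  shows "hprod A (replicate m s @ replicate n t) \<subseteq> B"
proof -
  let ?C = "{r \<in> carrier A. r \<star> s \<subseteq> B}"
  have "hprod A (replicate n t) \<subseteq> ?C"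
    using mn t st hmult_comm [of s t] s
    by (intro hprod_subset_hyperideal hyperideal_colon B s) auto
  moreover have T: "hprod A (replicate n t) \<subseteq> carrier A"
    using t by (intro hprod_closed) auto
  ultimately have base: "{s} <\<star>> hprod A (replicate n t) \<subseteq> B"
    using s by (subst hset_mult_comm) (auto simp: hset_mult_def)
  have "hprod A (replicate (Suc k) s @ replicate n t) \<subseteq> B" for k
  proof (induction k)
    case 0
    then show ?case using base mn by (simp add: hprod_Cons)
  next
    case (Suc k)
    then show ?case
      using hyperidealD(4) [OF B] s by (simp add: hset_mult_def) blast
  qed
  from this [of "m - 1"] show ?thesis using mn by simp
qed

end

section \<open>Consequences of the identity element\<close>

context comm_mult_hyperring_1
begin

text \<open>A power of \<open>\<one>\<close> may be larger than \<open>{\<one>}\<close>, but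
  \<open>\<one> \<in> \<one> \<star> \<one>\<close> keeps \<open>\<one>\<close> in it.\<close>

lemma hone_mem_hprod: "\<lbrakk>L \<noteq> []; set L \<subseteq> {\<one>}\<rbrakk> \<Longrightarrow> \<one> \<in> hprod A L"
proof (induction L rule: list_nonempty_induct)
  case (cons x L)
  then have "x = \<one>" "\<one> \<in> hprod A L" by auto
  then have "\<one> \<star> \<one> \<subseteq> hprod A (x # L)"
    using cons.hyps by (simp add: hprod_Cons hset_multI)
  then show ?case using hone_mem [OF hone_closed] by auto
qed simp

lemma one_not_in_proper_hyperideal:
  assumes "proper_hyperideal A P"
  shows "\<one> \<notin> P"
proof
  assume "\<one> \<in> P"
  have P: "hyperideal A P" "P \<noteq> carrier A"
    using assms unfolding proper_hyperideal_def by auto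
  have "a \<in> P" if "a \<in> carrier A" for a
    using hyperideal_mult_right [OF P(1) \<open>\<one> \<in> P\<close> that] hone_mem [OF that] by auto
  then show False using hyperidealD(1) [OF P(1)] P(2) by auto
qed

text \<open>Properness excludes the convention that the radical is the carrier when no prime
  hyperideal contains \<open>P\<close>. If \<open>\<one>\<close> were in the radical, a power of
  \<open>\<one>\<close> would lie in \<open>P\<close>, and that power contains
  \<open>\<one>\<close>.\<close>

lemma proper_hyperideal_hrad:
  assumes "proper_hyperideal A P" "C_hyperideal A P"
  shows "proper_hyperideal A (hrad A P)"
proof -
  have "\<one> \<notin> hrad A P"
  proof
    assume "\<one> \<in> hrad A P"
    then obtain L where "L \<noteq> []" "set L \<subseteq> {\<one>}" "hprod A L \<subseteq> P"
      using hrad_power [OF assms(2)] by metis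
    then show False
      using hone_mem_hprod [of L] one_not_in_proper_hyperideal [OF assms(1)] by auto
  qed
  then show ?thesis
    unfolding proper_hyperideal_def using hyperideal_hrad hone_closed by metis
qed

text \<open>With \<open>z\<close> inverting \<open>x\<close>, \<open>y\<close> belongs to
  \<open>\<one> \<star> y\<close>, hence to
  \<open>(z \<star> x) \<star> y = z \<star> (x \<star> y)\<close>, which lies in
  \<open>B\<close>.\<close>

lemma hyperideal_cancel_unit:
  assumes B: "hyperideal A B" and x: "x \<in> hunits A" and y: "y \<in> carrier A" and xy: "x \<star> y \<subseteq> B"
  shows "y \<in> B"
proof -
  obtain z where z: "x \<in> carrier A" "z \<in> carrier A" "\<one> \<in> z \<star> x"
    using x unfolding hunits_def by auto
  have "y \<in> (\<Union>w\<in>z \<star> x. w \<star> y)" using hone_mem [OF y] z(3) by auto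
  also have "\<dots> = (\<Union>w\<in>x \<star> y. z \<star> w)" using z(2,1) y by (rule hmult_assoc [symmetric])
  also have "\<dots> \<subseteq> B" using xy by (intro UN_least hyperidealD(4) [OF B _ z(2)]) auto
  finally show ?thesis .
qed

lemma hrad_prime_of_nonunits:
  assumes uv: "0 < v" "v < u" and abs: "absorbing_primary A u v P" and C: "C_hyperideal A P"
    and x: "x \<in> carrier A - hunits A" and y: "y \<in> carrier A - hunits A"
    and xy: "x \<star> y \<subseteq> hrad A P"
  shows "x \<in> hrad A P \<or> y \<in> hrad A P"
proof -
  have P: "hyperideal A P" using C unfolding C_hyperideal_def by blast
  obtain c where c: "c \<in> x \<star> y" "c \<in> hrad A P"
    using hmult_nonempty [of x y] x y xy by auto
  obtain L where L: "L \<noteq> []" "set L \<subseteq> {c}" "hprod A L \<subseteq> P"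
    using hrad_power [OF C c(2)] by metis
  define X Y where "X = map (\<lambda>_. x) L" and "Y = map (\<lambda>_. y) L"
  have X: "X \<noteq> []" "set X \<subseteq> {x}" and Y: "Y \<noteq> []" "set Y \<subseteq> {y}"
    using L(1) unfolding X_def Y_def by auto
  have XA: "set X \<subseteq> carrier A" and YA: "set Y \<subseteq> carrier A"
    using X Y x y by auto
  have "hprod A L \<subseteq> hprod A (X @ Y)"
    using hprod_subset_split [OF L(1,2) c(1)] x y hprod_append [OF X(1) Y(1) XA YA]
    unfolding X_def Y_def by simp
  \<comment> \<open>Nonemptiness makes the larger product \<open>hprod A (X @ Y)\<close> actually
    meet \<open>P\<close>.\<close>
  moreover have "hprod A L \<noteq> {}"
    using L(1,2) c(2) by (intro hprod_nonempty) (auto simp: hrad_def)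
  ultimately have "hprod A (X @ Y) \<subseteq> P"
    using L X XA YA by (intro C_hyperidealD [OF C]) auto
  then have XY: "hprod A X <\<star>> hprod A Y \<subseteq> P"
    using hprod_append [OF X(1) Y(1) XA YA] by simp
  \<comment> \<open>Absorption concerns lists of elements, so the two powers are represented by
    single elements.\<close>
  obtain s t where s: "s \<in> hprod A X" and t: "t \<in> hprod A Y"
    using hprod_nonempty [OF X(1) XA] hprod_nonempty [OF Y(1) YA] by auto
  have sA: "s \<in> carrier A - hunits A"
    using s hprod_closed [OF XA] hunits_hprod_factors [OF X(1) XA s] X x by (cases X) auto
  have tA: "t \<in> carrier A - hunits A"
    using t hprod_closed [OF YA] hunits_hprod_factors [OF Y(1) YA t] Y y by (cases Y) auto
  let ?R = "replicate v s @ replicate (u - v) t"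
  have "s \<star> t \<subseteq> P"
    using hset_multI [OF s t] XY by (rule subset_trans)
  then have "hprod A ?R \<subseteq> P"
    using sA tA uv P by (intro hprod_replicate_append_subset) auto
  moreover have "length ?R = u" "set ?R \<subseteq> carrier A - hunits A"
    using uv sA tA by auto
  ultimately have "hprod A (take v ?R) \<subseteq> P \<or> hprod A (drop v ?R) \<subseteq> hrad A P"
    using abs unfolding absorbing_primary_def by metis
  \<comment> \<open>Cutting the list at \<open>v\<close> separates the copies of \<open>s\<close>
    from those of \<open>t\<close>. The first alternative gives inclusion in \<open>P\<close>,
    weakened here to the radical to match the second.\<close>
  then have "hprod A (replicate v s) \<subseteq> hrad A P \<or> hprod A (replicate (u - v) t) \<subseteq> hrad A P"
    using subset_hrad [OF hyperidealD(1) [OF P]] by auto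
  then have "s \<in> hrad A P \<or> t \<in> hrad A P"
    using hprod_power_in_hrad [of "replicate v s" s P]
      hprod_power_in_hrad [of "replicate (u - v) t" t P] sA tA uv by auto
  then show ?thesis
    using hrad_root [OF C _ X s] hrad_root [OF C _ Y t] x y by auto
qed

end

theorem theorem2p7:
  fixes A :: "('a, 'm) hyperring_scheme" and u v :: nat and P :: "'a set"
  assumes "comm_mult_hyperring_1 A"
    and "0 < v" and "v < u"
    and "absorbing_primary A u v P"
    and "C_hyperideal A P"
  shows "prime_hyperideal A (hrad A P)"
proof -
  interpret comm_mult_hyperring_1 A by fact
  have "proper_hyperideal A (hrad A P)"
    using assms(4,5) proper_hyperideal_hrad unfolding absorbing_primary_def by simp
  moreover have "x \<in> hrad A P \<or> y \<in> hrad A P"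
    if xy: "x \<in> carrier A" "y \<in> carrier A" "x \<star>\<^bsub>A\<^esub> y \<subseteq> hrad A P" for x y
  proof -
    \<comment> \<open>Absorption covers only two nonunits. If one factor is a unit, it is cancelled
      from the left, so both orders of the product are needed.\<close>
    have "y \<star>\<^bsub>A\<^esub> x \<subseteq> hrad A P" using xy hmult_comm [of x y] by simp
    then show ?thesis
      using hyperideal_cancel_unit [OF hyperideal_hrad, of x y P]
        hyperideal_cancel_unit [OF hyperideal_hrad, of y x P]
        hrad_prime_of_nonunits [OF assms(2-), of x y] xy
      by auto
  qed
  ultimately show ?thesis unfolding prime_hyperideal_def by simp
qed

end
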